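(* Let $I\subseteq\mathbb{R}[x_1,\ldots,x_n]$ be a real radical ideal and $k$ a positive integer. Then $I$ is $(1,k)$-sos if and only if $I$ is $\mathrm{TH}_k$-exact.
   Context: $\mathbb{R}[\mathbf{x}]=\mathbb{R}[x_1,\ldots,x_n]$ and $\mathbb{R}[\mathbf{x}]_k$ is the set of polynomials of degree at most $k$; a polynomial is linear if it lies in $\mathbb{R}[\mathbf{x}]_1$. $\mathcal{V}_{\mathbb{R}}(I)$ is the set of common real zeros of $I$ in $\mathbb{R}^n$. $I$ is real radical if $I=\{f : f^{2m}+g_1^2+\cdots+g_t^2\in I \text{ for some } m\ge 1,\ g_1,\ldots,g_t\in\mathbb{R}[\mathbf{x}]\}$ (equivalently, $I$ is the vanishing ideal of $\mathcal{V}_{\mathbb{R}}(I)$). A polynomial $f$ is $k$-sos mod $I$ if there are $h_1,\ldots,h_t\in\mathbb{R}[\mathbf{x}]_k$ with $f-\sum_j h_j^2\in I$. $I$ is $(1,k)$-sos if every polynomial of degree at most $1$ that is non-negative on $\mathcal{V}_{\mathbb{R}}(I)$ is $k$-sos mod $I$. The $k$-th theta body is $\mathrm{TH}_k(I):=\{\mathbf{x}\in\mathbb{R}^n : f(\mathbf{x})\ge0 \text{ for every linear } f \text{ that is } k\text{-sos mod } I\}$, and $I$ is $\mathrm{TH}_k$-exact if $\mathrm{TH}_k(I)=\mathrm{cl}(\mathrm{conv}(\mathcal{V}_{\mathbb{R}}(I)))$. *)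

theory Defs
  imports "HOL-Analysis.Analysis" "HOL-Library.Poly_Mapping"
begin

text \<open>
  The ring of real polynomials in the variables indexed by the finite type \<open>'n\<close>, with
  \<open>CARD('n)\<close> in the role of the number of variables. Monomials are their exponent vectors, and
  the multiplication of \<^theory>\<open>HOL-Library.Poly_Mapping\<close> is convolution of the coefficients,
  i.e. the usual product of polynomials.
\<close>

type_synonym 'n rpoly = "('n \<Rightarrow>\<^sub>0 nat) \<Rightarrow>\<^sub>0 real"

definition eval_rpoly :: "'n::finite rpoly \<Rightarrow> real ^ 'n \<Rightarrow> real" where
  "eval_rpoly p x =
     (\<Sum>a\<in>Poly_Mapping.keys p. Poly_Mapping.lookup p a * (\<Prod>i\<in>UNIV. (x $ i) ^ Poly_Mapping.lookup a i))"

text \<open>Total degree at most \<open>k\<close>; the zero polynomial is included for every \<open>k\<close>.\<close>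

definition polys_upto :: "nat \<Rightarrow> 'n::finite rpoly set" where
  "polys_upto k = {p. \<forall>a\<in>Poly_Mapping.keys p. (\<Sum>i\<in>UNIV. Poly_Mapping.lookup a i) \<le> k}"

text \<open>The whole ring counts as an ideal.\<close>

definition poly_ideal :: "'n::finite rpoly set \<Rightarrow> bool" where
  "poly_ideal I \<longleftrightarrow> 0 \<in> I \<and> (\<forall>p\<in>I. \<forall>q\<in>I. p + q \<in> I) \<and> (\<forall>p\<in>I. \<forall>q. q * p \<in> I)"

definition real_variety :: "'n::finite rpoly set \<Rightarrow> (real ^ 'n) set" where
  "real_variety I = {x. \<forall>p\<in>I. eval_rpoly p x = 0}"

definition real_radical :: "'n::finite rpoly set \<Rightarrow> bool" where
  "real_radical I \<longleftrightarrow>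
     I = {f. \<exists>m\<ge>1. \<exists>(t::nat) g. f ^ (2 * m) + (\<Sum>j<t. (g j)\<^sup>2) \<in> I}"

definition ksos_mod :: "nat \<Rightarrow> 'n::finite rpoly set \<Rightarrow> 'n rpoly \<Rightarrow> bool" where
  "ksos_mod k I f \<longleftrightarrow>
     (\<exists>(t::nat) h. (\<forall>j<t. h j \<in> polys_upto k) \<and> f - (\<Sum>j<t. (h j)\<^sup>2) \<in> I)"

definition one_k_sos :: "nat \<Rightarrow> 'n::finite rpoly set \<Rightarrow> bool" where
  "one_k_sos k I \<longleftrightarrow>
     (\<forall>f\<in>polys_upto 1. (\<forall>x\<in>real_variety I. eval_rpoly f x \<ge> 0) \<longrightarrow> ksos_mod k I f)"

definition theta_body :: "nat \<Rightarrow> 'n::finite rpoly set \<Rightarrow> (real ^ 'n) set" where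
  "theta_body k I = {x. \<forall>f\<in>polys_upto 1. ksos_mod k I f \<longrightarrow> eval_rpoly f x \<ge> 0}"

definition theta_exact :: "nat \<Rightarrow> 'n::finite rpoly set \<Rightarrow> bool" where
  "theta_exact k I \<longleftrightarrow> theta_body k I = closure (convex hull (real_variety I))"

end

theory Submission
  imports Defs
begin

text \<open>
  If every affine polynomial that is nonnegative on the variety is \<open>k\<close>-sos, then separating a
  point from the closed convex hull of the variety exhibits a \<open>k\<close>-sos affine polynomial that is
  negative there.

  For the converse, the affine polynomials that are \<open>k\<close>-sos modulo \<open>I\<close> form a closed convex
  cone. Indeed, choose monomials \<open>B\<close> that represent a basis of the polynomials of degree at most
  \<open>k\<close> modulo \<open>I\<close>; sums of squares are then given by positive semidefinite Gram matrices over
  \<open>B\<close>. As \<open>I\<close> is real radical, no nonzero such matrix is mapped into \<open>I\<close>, so a normalisation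
  and compactness argument gives closedness. An affine \<open>f\<close> outside the cone is separated from it
  by a functional \<open>z \<mapsto> (y, s) \<bullet> z\<close> with \<open>s \<ge> 0\<close>. After adding a small multiple of a point
  of the theta body we get \<open>s > 0\<close>, and \<open>y / s\<close> is a point of the theta body at which \<open>f\<close> is
  negative. If the theta body is empty, the same argument shows that \<open>-1\<close> is \<open>k\<close>-sos, whence
  \<open>1 \<in> I\<close> because \<open>I\<close> is real radical. The real Nullstellensatz is not needed.
\<close>

subsection \<open>Finitely supported functions as a vector space\<close>

text \<open>The vector space structure lets \<open>subspace\<close>, \<open>linear\<close> and
  \<open>independent\<close> be used for polynomials, with ideals as subspaces.\<close>

instantiation poly_mapping :: (type, real_vector) real_vector
begin

lift_definition scaleR_poly_mapping :: "real \<Rightarrow> ('a \<Rightarrow>\<^sub>0 'b) \<Rightarrow> 'a \<Rightarrow>\<^sub>0 'b"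
  is "\<lambda>r f a. r *\<^sub>R f a"
  by (erule rev_finite_subset) auto

instance
  by standard (transfer; simp add: fun_eq_iff algebra_simps)+

end

lemma lookup_scaleR [simp]: "Poly_Mapping.lookup (r *\<^sub>R p) a = r *\<^sub>R Poly_Mapping.lookup p a"
  by transfer simp

lemma scaleR_eq_single_mult:
  fixes p :: "'a::comm_monoid_add \<Rightarrow>\<^sub>0 real"
  shows "r *\<^sub>R p = Poly_Mapping.single 0 r * p"
  unfolding mult_map_scale_conv_mult[symmetric]
  by (rule poly_mapping_eqI) (simp add: map.rep_eq when_def)

lemma scaleR_single: "r *\<^sub>R Poly_Mapping.single a c = Poly_Mapping.single a (r *\<^sub>R c)"
  by (rule poly_mapping_eqI) (simp add: lookup_single when_def)

lemma poly_mapping_eq_sum_single: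
  assumes "finite A" "Poly_Mapping.keys p \<subseteq> A"
  shows "p = (\<Sum>a\<in>A. Poly_Mapping.single a (Poly_Mapping.lookup p a))"
proof (rule poly_mapping_eqI)
  fix a
  show "Poly_Mapping.lookup p a =
      Poly_Mapping.lookup (\<Sum>a\<in>A. Poly_Mapping.single a (Poly_Mapping.lookup p a)) a"
    using assms by (auto simp: lookup_sum lookup_single when_def in_keys_iff)
qed

subsection \<open>Positive semidefinite matrices\<close>

text \<open>Indices range over a set and not a type because the monomial basis used later depends on
  \<open>I\<close> and \<open>k\<close>. Entries outside \<open>B\<close> are unconstrained.\<close>

definition psd_on :: "'a set \<Rightarrow> ('a \<Rightarrow> 'a \<Rightarrow> real) \<Rightarrow> bool" where
  "psd_on B G \<longleftrightarrow> (\<forall>a\<in>B. \<forall>b\<in>B. G a b = G b a) \<and>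
     (\<forall>x. 0 \<le> (\<Sum>a\<in>B. \<Sum>b\<in>B. G a b * x a * x b))"

lemma psd_on_outer_sum:
  assumes "finite B"
  shows "psd_on B (\<lambda>a b. \<Sum>j<(t::nat). c j a * c j b)"
proof -
  have "(\<Sum>a\<in>B. \<Sum>b\<in>B. (\<Sum>j<t. c j a * c j b) * x a * x b) = (\<Sum>j<t. (\<Sum>a\<in>B. c j a * x a)\<^sup>2)" for x
  proof -
    have "(\<Sum>j<t. (\<Sum>a\<in>B. c j a * x a)\<^sup>2) = (\<Sum>j<t. \<Sum>a\<in>B. \<Sum>b\<in>B. c j a * c j b * x a * x b)"
      by (simp add: power2_eq_square sum_product mult_ac)
    also have "\<dots> = (\<Sum>a\<in>B. \<Sum>b\<in>B. \<Sum>j<t. c j a * c j b * x a * x b)"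
      by (subst sum.swap, rule sum.cong, simp, subst sum.swap, simp)
    finally show ?thesis by (simp add: sum_distrib_right)
  qed
  then show ?thesis
    by (simp add: psd_on_def mult.commute sum_nonneg)
qed

lemma psd_on_limit:
  assumes "\<And>m. psd_on B (G m)"
    and "\<And>a b. a \<in> B \<Longrightarrow> b \<in> B \<Longrightarrow> (\<lambda>m. G m a b) \<longlonglongrightarrow> H a b"
  shows "psd_on B H"
  unfolding psd_on_def
proof (intro conjI ballI allI)
  fix a b assume ab: "a \<in> B" "b \<in> B"
  have "(\<lambda>m. G m a b) = (\<lambda>m. G m b a)"
    using assms(1) ab by (simp add: psd_on_def)
  then show "H a b = H b a"
    using LIMSEQ_unique assms(2) ab by metis
next
  fix x
  have "(\<lambda>m. \<Sum>a\<in>B. \<Sum>b\<in>B. G m a b * x a * x b) \<longlonglongrightarrow> (\<Sum>a\<in>B. \<Sum>b\<in>B. H a b * x a * x b)"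
    by (intro tendsto_intros assms(2))
  then show "0 \<le> (\<Sum>a\<in>B. \<Sum>b\<in>B. H a b * x a * x b)"
    using assms(1) by (intro LIMSEQ_le_const) (auto simp: psd_on_def)
qed

lemma psd_on_scale:
  assumes "psd_on B G" "0 \<le> r"
  shows "psd_on B (\<lambda>a b. r * G a b)"
proof -
  have "(\<Sum>a\<in>B. \<Sum>b\<in>B. r * G a b * x a * x b) = r * (\<Sum>a\<in>B. \<Sum>b\<in>B. G a b * x a * x b)" for x
    by (simp add: sum_distrib_left mult_ac)
  then show ?thesis using assms by (simp add: psd_on_def)
qed

lemma psd_on_add:
  assumes "psd_on B G" "psd_on B H"
  shows "psd_on B (\<lambda>a b. G a b + H a b)"
proof -
  have "(\<Sum>a\<in>B. \<Sum>b\<in>B. (G a b + H a b) * x a * x b)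
      = (\<Sum>a\<in>B. \<Sum>b\<in>B. G a b * x a * x b) + (\<Sum>a\<in>B. \<Sum>b\<in>B. H a b * x a * x b)" for x
    by (simp add: sum.distrib algebra_simps)
  then show ?thesis using assms by (simp add: psd_on_def)
qed

text \<open>Cholesky factorisation by induction on \<open>B\<close>: splitting off the index
  \<open>b\<close> leaves the Schur complement, which is again positive semidefinite, and the row of
  \<open>b\<close> supplies one further vector.\<close>

lemma psd_on_decomp:
  assumes "finite B" "psd_on B G"
  shows "\<exists>(t::nat) c. \<forall>a\<in>B. \<forall>b\<in>B. G a b = (\<Sum>j<t. c j a * c j b)"
  using assms
proof (induction B arbitrary: G rule: finite_induct)
  case empty
  then show ?case by simp
next
  case (insert b B)
  define d where "d = G b b"
  define S where "S x = (\<Sum>a\<in>B. G b a * x a)" for x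
  have sym: "G a e = G e a" if "a \<in> insert b B" "e \<in> insert b B" for a e
    using insert.prems that unfolding psd_on_def by blast
  have expand: "(\<Sum>a\<in>insert b B. \<Sum>e\<in>insert b B. G a e * x a * x e)
      = (\<Sum>a\<in>B. \<Sum>e\<in>B. G a e * x a * x e) + 2 * x b * S x + d * (x b)\<^sup>2" for x
  proof -
    have "(\<Sum>a\<in>B. G a b * x a * x b) = x b * S x" "(\<Sum>e\<in>B. G b e * x b * x e) = x b * S x"
      using sym by (auto simp: S_def sum_distrib_left intro!: sum.cong)
    then show ?thesis
      using insert.hyps by (simp add: sum.distrib d_def power2_eq_square algebra_simps)
  qed
  \<comment> \<open>The coordinate at \<open>b\<close> is replaced by a free real \<open>s\<close>;
    neither \<open>S\<close> nor the form on \<open>B\<close> sees it.\<close>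
  have nonneg: "0 \<le> (\<Sum>a\<in>B. \<Sum>e\<in>B. G a e * x a * x e) + 2 * s * S x + d * s\<^sup>2" for x s
  proof -
    have *: "(\<Sum>a\<in>B. \<Sum>e\<in>B. G a e * (x(b := s)) a * (x(b := s)) e)
      = (\<Sum>a\<in>B. \<Sum>e\<in>B. G a e * x a * x e)" "S (x(b := s)) = S x"
      using insert.hyps by (auto simp: S_def intro!: sum.cong)
    have "0 \<le> (\<Sum>a\<in>insert b B. \<Sum>e\<in>insert b B. G a e * (x(b := s)) a * (x(b := s)) e)"
      using insert.prems unfolding psd_on_def by blast
    then show ?thesis unfolding expand * by simp
  qed
  have d: "0 \<le> d"
    using nonneg[of "\<lambda>_. 0" 1] by (simp add: S_def)
  have zero: "G b a = 0" if "d = 0" "a \<in> B" for a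
  proof (rule ccontr)
    assume ne: "G b a \<noteq> 0"
    let ?x = "\<lambda>e. if e = a then 1 else 0 :: real"
    have Gx: "(\<Sum>e\<in>B. G i e * ?x i * ?x e) = (if i = a then G a a else 0)" for i
      using that insert.hyps by (cases "i = a") (simp_all add: if_distrib[of "\<lambda>x. _ * x"] cong: if_cong)
    have "S ?x = G b a"
      using that insert.hyps by (simp add: S_def if_distrib[of "\<lambda>x. _ * x"] cong: if_cong)
    moreover have "(\<Sum>i\<in>B. \<Sum>e\<in>B. G i e * ?x i * ?x e) = G a a"
      using that insert.hyps unfolding Gx by simp
    \<comment> \<open>With \<open>d = 0\<close> the form is affine in \<open>s\<close>, and this
      \<open>s\<close> makes its value -1.\<close>
    ultimately have "0 \<le> G a a + 2 * (- (G a a + 1) / (2 * G b a)) * G b a"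
      using nonneg[of ?x "- (G a a + 1) / (2 * G b a)"] that by simp
    then show False using ne by (simp add: field_simps)
  qed
  have "psd_on B (\<lambda>a e. G a e - G b a * G b e / d)"
    unfolding psd_on_def
  proof (intro conjI ballI allI)
    fix x
    have "(\<Sum>a\<in>B. \<Sum>e\<in>B. (G a e - G b a * G b e / d) * x a * x e)
        = (\<Sum>a\<in>B. \<Sum>e\<in>B. G a e * x a * x e) - (S x)\<^sup>2 / d"
      by (simp add: S_def power2_eq_square sum_product sum_subtractf sum_divide_distrib
          algebra_simps)
    \<comment> \<open>For \<open>d > 0\<close> this is the value at the minimiser
      \<open>s = - S x / d\<close>. For \<open>d = 0\<close> division by zero yields 0 and both
      sides agree.\<close>
    also have "\<dots> = (\<Sum>a\<in>B. \<Sum>e\<in>B. G a e * x a * x e) + 2 * (- S x / d) * S x + d * (- S x / d)\<^sup>2"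
      by (cases "d = 0") (auto simp: field_simps power2_eq_square)
    also have "\<dots> \<ge> 0" by (rule nonneg)
    finally show "0 \<le> (\<Sum>a\<in>B. \<Sum>e\<in>B. (G a e - G b a * G b e / d) * x a * x e)" .
  qed (use sym in \<open>auto simp: mult.commute\<close>)
  from insert.IH[OF this] obtain t :: nat and c where
    c: "\<And>a e. a \<in> B \<Longrightarrow> e \<in> B \<Longrightarrow> G a e - G b a * G b e / d = (\<Sum>j<t. c j a * c j e)"
    by blast
  \<comment> \<open>The new vector has index \<open>t\<close>; the old ones are extended by 0 at
    \<open>b\<close>.\<close>
  define c' where "c' j a = (if j = t then G b a / sqrt d else if a = b then 0 else c j a)" for j a
  have last: "c' t a * c' t e = G b a * G b e / d" for a e
    using d by (simp add: c'_def)
  have "G a e = (\<Sum>j<Suc t. c' j a * c' j e)" if ae: "a \<in> insert b B" "e \<in> insert b B" for a e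
  proof (cases "a = b \<or> e = b")
    case True
    then have "(\<Sum>j<t. c' j a * c' j e) = 0" by (auto simp: c'_def)
    \<comment> \<open>If \<open>d = 0\<close>, then \<open>zero\<close> makes the whole row of
      \<open>b\<close> vanish, so the quotient 0 is the right value.\<close>
    moreover have "G b a * G b e / d = G a e"
      using True ae zero sym[OF ae] d_def by (cases "d = 0") auto
    ultimately show ?thesis by (simp add: last)
  next
    case False
    then have "(\<Sum>j<t. c' j a * c' j e) = (\<Sum>j<t. c j a * c j e)" by (auto simp: c'_def)
    then show ?thesis using c[of a e] False ae by (simp add: last)
  qed
  then show ?case by blast
qed

subsection \<open>Closedness of cones modulo a subspace\<close>

text \<open>A basis of \<open>S\<close> stays independent when \<open>p\<close> is added, so a
  functional may be prescribed freely on the enlarged set. It serves as a purely algebraic test for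
  membership in \<open>S\<close>.\<close>

lemma separate_subspace_point:
  fixes S :: "'v::real_vector set"
  assumes "subspace S" "p \<notin> S"
  obtains \<phi> :: "'v \<Rightarrow> real" where "linear \<phi>" "\<And>x. x \<in> S \<Longrightarrow> \<phi> x = 0" "\<phi> p = 1"
proof -
  obtain B where B: "B \<subseteq> S" "independent B" "S \<subseteq> span B"
    by (rule basis_exists[of S]) auto
  then have sB: "span B = S" using assms(1) by (simp add: span_minimal subset_antisym)
  then have "independent (insert p B)" using assms(2) B(2) by (simp add: independent_insert)
  from linear_independent_extend[OF this, of "\<lambda>x. if x = p then 1 else 0 :: real"]
  obtain \<phi> :: "'v \<Rightarrow> real" where \<phi>: "linear \<phi>" "\<forall>x\<in>insert p B. \<phi> x = (if x = p then 1 else 0)"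
    by auto
  have "\<phi> x = 0" if "x \<in> B" for x
    using \<phi>(2) that B(1) assms(2) by auto
  then have "\<phi> x = 0" if "x \<in> S" for x
    using linear_eq_0_on_span[OF \<phi>(1)] that sB by blast
  then show ?thesis using that \<phi> by simp
qed

text \<open>
  The vector space \<open>'v\<close> carries no topology: linear functionals that vanish on \<open>I\<close> transport
  limits from \<open>'e\<close> and from the coefficients.
\<close>

lemma closed_linear_preimage_cone:
  fixes F :: "'e::euclidean_space \<Rightarrow> 'v::real_vector" and u :: "'t \<Rightarrow> 'v"
  assumes F: "linear F" and I: "subspace I" and T: "finite T"
    and cone: "\<And>g r. g \<in> C \<Longrightarrow> 0 \<le> r \<Longrightarrow> (\<lambda>t. r * g t) \<in> C"
    and lim: "\<And>f g. (\<And>m. f m \<in> C) \<Longrightarrow> (\<And>t. t \<in> T \<Longrightarrow> (\<lambda>m. f m t) \<longlonglongrightarrow> g t) \<Longrightarrow> g \<in> C"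
    and anis: "\<And>g t. g \<in> C \<Longrightarrow> (\<Sum>t\<in>T. g t *\<^sub>R u t) \<in> I \<Longrightarrow> t \<in> T \<Longrightarrow> g t = 0"
  shows "closed {z. \<exists>g\<in>C. F z - (\<Sum>t\<in>T. g t *\<^sub>R u t) \<in> I}"
  unfolding closed_sequential_limits
proof (intro allI impI, elim conjE)
  fix z l
  assume "\<forall>m. z m \<in> {z. \<exists>g\<in>C. F z - (\<Sum>t\<in>T. g t *\<^sub>R u t) \<in> I}" and zl: "z \<longlonglongrightarrow> l"
  then obtain g where g: "\<And>m. g m \<in> C" "\<And>m. F (z m) - (\<Sum>t\<in>T. g m t *\<^sub>R u t) \<in> I"
    by (simp add: Bex_def) metis
  \<comment> \<open>With this scaling, \<open>(r m, h m)\<close> stays on the unit sphere of the 1-norm even if \<open>g\<close> is unbounded.\<close>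
  define r where "r m = 1 / (1 + (\<Sum>t\<in>T. \<bar>g m t\<bar>))" for m
  define h where "h m t = r m * g m t" for m t
  have pos: "0 < 1 + (\<Sum>t\<in>T. \<bar>g m t\<bar>)" for m
    by (simp add: add_pos_nonneg sum_nonneg)
  have r0: "0 \<le> r m" for m
    using pos[of m] by (simp add: r_def)
  \<comment> \<open>Expressing \<open>r\<close> through \<open>h\<close> makes convergence of
    \<open>r\<close> a consequence of convergence of \<open>h\<close>.\<close>
  have r_eq: "r m = 1 - (\<Sum>t\<in>T. \<bar>h m t\<bar>)" for m
  proof -
    have "(\<Sum>t\<in>T. \<bar>h m t\<bar>) = r m * (\<Sum>t\<in>T. \<bar>g m t\<bar>)"
      using r0[of m] by (simp add: h_def abs_mult sum_distrib_left)
    then show ?thesis using pos[of m] by (simp add: r_def field_simps)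
  qed
  have hC: "h m \<in> C" for m
    using cone[OF g(1) r0] by (simp add: h_def[abs_def])
  have hI: "F (r m *\<^sub>R z m) - (\<Sum>t\<in>T. h m t *\<^sub>R u t) \<in> I" for m
    using subspace_scale[OF I g(2)[of m], of "r m"]
    by (simp add: h_def linear_scale[OF F] scaleR_right_diff_distrib scaleR_sum_right)
  \<comment> \<open>Bolzano-Weierstrass on the finitely many coordinates in \<open>T\<close>, each
    bounded by 1.\<close>
  have "\<exists>l q. strict_mono (q::nat \<Rightarrow> nat) \<and>
     (\<forall>e>0. \<forall>\<^sub>F n in sequentially. \<forall>i\<in>T. dist (h (q n) i) (l i) < e)"
  proof (rule compact_lemma_general[where proj = "\<lambda>x. x" and unproj = "\<lambda>x. x" and basis = T,
      rule_format])
    fix t assume "t \<in> T"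
    have "\<bar>h m t\<bar> \<le> 1" for m
      using member_le_sum[OF \<open>t \<in> T\<close>, of "\<lambda>t. \<bar>h m t\<bar>"] T r_eq[of m] r0[of m] by simp
    then show "bounded ((\<lambda>x. x t) ` range h)"
      by (auto simp: bounded_iff)
  qed (use T in auto)
  then obtain h' q where q: "strict_mono (q::nat \<Rightarrow> nat)"
    and q': "\<And>e. e > 0 \<Longrightarrow> \<forall>\<^sub>F n in sequentially. \<forall>i\<in>T. dist (h (q n) i) (h' i) < e"
    by blast
  have hlim: "(\<lambda>n. h (q n) t) \<longlonglongrightarrow> h' t" if "t \<in> T" for t
    unfolding tendsto_iff
  proof (intro allI impI)
    fix e :: real assume "0 < e"
    show "\<forall>\<^sub>F n in sequentially. dist (h (q n) t) (h' t) < e"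
      by (rule eventually_mono[OF q'[OF \<open>0 < e\<close>]]) (use that in blast)
  qed
  have h'C: "h' \<in> C"
    by (rule lim[of "\<lambda>n. h (q n)"]) (use hC hlim in auto)
  define r' where "r' = 1 - (\<Sum>t\<in>T. \<bar>h' t\<bar>)"
  have rlim: "(\<lambda>n. r (q n)) \<longlonglongrightarrow> r'"
    unfolding r_eq r'_def by (intro tendsto_intros hlim)
  have r'0: "0 \<le> r'"
    by (rule LIMSEQ_le_const[OF rlim]) (use r0 in auto)
  \<comment> \<open>Otherwise some functional vanishing on \<open>I\<close> takes the value 1 here,
    although it is 0 along the sequence and its values converge.\<close>
  have limI: "F (r' *\<^sub>R l) - (\<Sum>t\<in>T. h' t *\<^sub>R u t) \<in> I"
  proof (rule ccontr)
    assume "\<not> ?thesis"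
    from separate_subspace_point[OF I this] obtain \<phi> :: "'v \<Rightarrow> real" where
      \<phi>: "linear \<phi>" "\<And>x. x \<in> I \<Longrightarrow> \<phi> x = 0"
      "\<phi> (F (r' *\<^sub>R l) - (\<Sum>t\<in>T. h' t *\<^sub>R u t)) = 1"
      by blast
    have eq: "\<phi> (F x - (\<Sum>t\<in>T. k t *\<^sub>R u t)) = \<phi> (F x) - (\<Sum>t\<in>T. k t * \<phi> (u t))" for x k
      by (simp add: linear_diff[OF \<phi>(1)] linear_sum[OF \<phi>(1)] linear_scale[OF \<phi>(1)])
    have "bounded_linear (\<lambda>x. \<phi> (F x))"
      using linear_compose[OF F \<phi>(1)] by (simp add: linear_conv_bounded_linear o_def)
    then have "(\<lambda>n. \<phi> (F (r (q n) *\<^sub>R z (q n))) - (\<Sum>t\<in>T. h (q n) t * \<phi> (u t)))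
        \<longlonglongrightarrow> \<phi> (F (r' *\<^sub>R l)) - (\<Sum>t\<in>T. h' t * \<phi> (u t))"
      using LIMSEQ_subseq_LIMSEQ[OF zl q]
      by (intro tendsto_intros hlim rlim bounded_linear.tendsto[of "\<lambda>x. \<phi> (F x)"])
        (simp_all add: o_def)
    moreover have "\<phi> (F (r (q n) *\<^sub>R z (q n))) - (\<Sum>t\<in>T. h (q n) t * \<phi> (u t)) = 0" for n
      using \<phi>(2)[OF hI] by (simp only: eq)
    ultimately have "(\<lambda>n. 0) \<longlonglongrightarrow> \<phi> (F (r' *\<^sub>R l)) - (\<Sum>t\<in>T. h' t * \<phi> (u t))"
      by (simp only:)
    from LIMSEQ_unique[OF this tendsto_const]
    have "\<phi> (F (r' *\<^sub>R l)) - (\<Sum>t\<in>T. h' t * \<phi> (u t)) = 0" .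
    then show False using \<phi>(3) by (simp only: eq)
  qed
  \<comment> \<open>If \<open>r'\<close> were 0, then \<open>anis\<close> would force
    \<open>h'\<close> to vanish on \<open>T\<close>, whereas \<open>r' = 0\<close> says that its
    1-norm is 1.\<close>
  have "r' \<noteq> 0"
  proof
    assume "r' = 0"
    then have "(\<Sum>t\<in>T. h' t *\<^sub>R u t) \<in> I"
      using subspace_neg[OF I limI] linear_0[OF F] by simp
    then have "h' t = 0" if "t \<in> T" for t using anis h'C that by blast
    then show False using \<open>r' = 0\<close> by (simp add: r'_def)
  qed
  have "(\<lambda>t. inverse r' * h' t) \<in> C" using cone[OF h'C] r'0 by simp
  moreover have "F l - (\<Sum>t\<in>T. (inverse r' * h' t) *\<^sub>R u t) \<in> I"
    using subspace_scale[OF I limI, of "inverse r'"] \<open>r' \<noteq> 0\<close>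
    by (simp add: linear_scale[OF F] scaleR_right_diff_distrib scaleR_sum_right)
  ultimately show "l \<in> {z. \<exists>g\<in>C. F z - (\<Sum>t\<in>T. g t *\<^sub>R u t) \<in> I}"
    by (intro CollectI bexI[of _ "\<lambda>t. inverse r' * h' t"])
qed

subsection \<open>Evaluation and affine polynomials\<close>

lemma eval_rpoly_superset:
  assumes "finite A" "Poly_Mapping.keys p \<subseteq> A"
  shows "eval_rpoly p x =
    (\<Sum>a\<in>A. Poly_Mapping.lookup p a * (\<Prod>i\<in>UNIV. (x $ i) ^ Poly_Mapping.lookup a i))"
  unfolding eval_rpoly_def
  by (rule sum.mono_neutral_left) (use assms in \<open>auto simp: in_keys_iff\<close>)

lemma linear_eval_rpoly: "linear (\<lambda>p. eval_rpoly p x)"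
proof (rule linearI)
  fix p q :: "'a rpoly"
  let ?A = "Poly_Mapping.keys p \<union> Poly_Mapping.keys q"
  have "Poly_Mapping.keys (p + q) \<subseteq> ?A" by (rule keys_add)
  then show "eval_rpoly (p + q) x = eval_rpoly p x + eval_rpoly q x"
    by (simp add: eval_rpoly_superset[of ?A] lookup_add distrib_right sum.distrib)
next
  fix r and p :: "'a rpoly"
  have "Poly_Mapping.keys (r *\<^sub>R p) \<subseteq> Poly_Mapping.keys p" by (auto simp: in_keys_iff)
  then show "eval_rpoly (r *\<^sub>R p) x = r *\<^sub>R eval_rpoly p x"
    by (simp add: eval_rpoly_superset[of "Poly_Mapping.keys p"] sum_distrib_left mult_ac)
qed

lemmas eval_rpoly_linear = linear_add[OF linear_eval_rpoly] linear_diff[OF linear_eval_rpoly]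
  linear_sum[OF linear_eval_rpoly] linear_0[OF linear_eval_rpoly]

lemma eval_rpoly_single:
  "eval_rpoly (Poly_Mapping.single a c) x = c * (\<Prod>i\<in>UNIV. (x $ i) ^ Poly_Mapping.lookup a i)"
  by (simp add: eval_rpoly_def)

text \<open>Both sides are bilinear, so it suffices to compare them on monomials.\<close>

lemma eval_rpoly_mult: "eval_rpoly (p * q) x = eval_rpoly p x * eval_rpoly q x"
proof -
  let ?s = "\<lambda>p a. Poly_Mapping.single a (Poly_Mapping.lookup p a)"
  have single: "eval_rpoly (?s p a * ?s q b) x = eval_rpoly (?s p a) x * eval_rpoly (?s q b) x" for a b
    by (simp add: mult_single eval_rpoly_single lookup_add power_add prod.distrib)
  have p: "p = (\<Sum>a\<in>Poly_Mapping.keys p. ?s p a)" and q: "q = (\<Sum>a\<in>Poly_Mapping.keys q. ?s q a)"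
    by (rule poly_mapping_eq_sum_single; simp)+
  have "p * q = (\<Sum>a\<in>Poly_Mapping.keys p. \<Sum>b\<in>Poly_Mapping.keys q. ?s p a * ?s q b)"
    by (subst p, subst q) (rule sum_product)
  then have "eval_rpoly (p * q) x =
      (\<Sum>a\<in>Poly_Mapping.keys p. eval_rpoly (?s p a) x) * (\<Sum>b\<in>Poly_Mapping.keys q. eval_rpoly (?s q b) x)"
    by (simp add: eval_rpoly_linear single sum_product)
  also have "\<dots> = eval_rpoly p x * eval_rpoly q x"
    by (simp add: p[symmetric] q[symmetric] eval_rpoly_linear[symmetric])
  finally show ?thesis .
qed

text \<open>Slope and constant term form a point of a Euclidean space, which provides the topology
  and inner product needed for separation.\<close>

definition affine_poly :: "(real ^ 'n) \<times> real \<Rightarrow> 'n::finite rpoly" where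
  "affine_poly z = Poly_Mapping.single 0 (snd z) +
     (\<Sum>i\<in>UNIV. Poly_Mapping.single (Poly_Mapping.single i 1) (fst z $ i))"

lemma linear_affine_poly: "linear affine_poly"
  by (rule linearI) (simp_all add: affine_poly_def single_add sum.distrib scaleR_right_distrib
      scaleR_sum_right scaleR_single add_ac)

lemma eval_affine_poly: "eval_rpoly (affine_poly z) x = fst z \<bullet> x + snd z"
proof -
  have "(\<Prod>j\<in>UNIV. x $ j ^ Poly_Mapping.lookup (Poly_Mapping.single i 1) j) = x $ i" for i
  proof -
    have "(\<Prod>j\<in>UNIV. x $ j ^ Poly_Mapping.lookup (Poly_Mapping.single i 1) j)
        = (\<Prod>j\<in>UNIV. if j = i then x $ j else 1)"
      by (rule prod.cong) (auto simp: lookup_single when_def)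
    then show ?thesis by simp
  qed
  then show ?thesis
    by (simp add: affine_poly_def eval_rpoly_linear eval_rpoly_single inner_vec_def)
qed

lemma polys_upto_single:
  assumes "(\<Sum>i\<in>UNIV. Poly_Mapping.lookup a i) \<le> k"
  shows "Poly_Mapping.single a c \<in> polys_upto k"
  using assms by (auto simp: polys_upto_def)

lemma polys_upto_add: "p \<in> polys_upto k \<Longrightarrow> q \<in> polys_upto k \<Longrightarrow> p + q \<in> polys_upto k"
  using keys_add[of p q] by (auto simp: polys_upto_def)

lemma polys_upto_sum: "(\<And>a. a \<in> A \<Longrightarrow> f a \<in> polys_upto k) \<Longrightarrow> sum f A \<in> polys_upto k"
  by (induction A rule: infinite_finite_induct) (simp_all add: polys_upto_add, simp_all add: polys_upto_def)

lemma affine_poly_in_polys_upto: "affine_poly z \<in> polys_upto 1"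
  unfolding affine_poly_def
  by (intro polys_upto_add polys_upto_sum polys_upto_single) (simp_all add: lookup_single when_def)

text \<open>An exponent vector of total degree at most 1 is zero or a unit vector.\<close>

lemma polys_upto_1_cases:
  fixes f :: "'n::finite rpoly"
  assumes "f \<in> polys_upto 1"
  obtains z where "f = affine_poly z"
proof -
  let ?e = "\<lambda>i::'n. Poly_Mapping.single i (1::nat)"
  have keys: "Poly_Mapping.keys f \<subseteq> insert 0 (range ?e)"
  proof
    fix a assume a: "a \<in> Poly_Mapping.keys f"
    show "a \<in> insert 0 (range ?e)"
    proof (cases "a = 0")
      case False
      then obtain i where i: "Poly_Mapping.lookup a i \<noteq> 0"
        by (metis poly_mapping_eqI lookup_zero)
      have "Poly_Mapping.lookup a i + (\<Sum>j\<in>UNIV - {i}. Poly_Mapping.lookup a j) \<le> 1"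
        using assms a by (simp add: polys_upto_def sum.remove[of UNIV i])
      then have "Poly_Mapping.lookup a i = 1" "(\<Sum>j\<in>UNIV - {i}. Poly_Mapping.lookup a j) = 0"
        using i by linarith+
      then have "a = ?e i"
        by (intro poly_mapping_eqI) (auto simp: lookup_single when_def)
      then show ?thesis by blast
    qed simp
  qed
  have inj: "inj ?e" by (rule injI) (metis lookup_single_eq lookup_single_not_eq zero_neq_one)
  have nz: "0 \<notin> range ?e" by (metis lookup_single_eq lookup_zero rangeE zero_neq_one)
  have "f = (\<Sum>a\<in>insert 0 (range ?e). Poly_Mapping.single a (Poly_Mapping.lookup f a))"
    by (rule poly_mapping_eq_sum_single) (use keys in auto)
  also have "\<dots> = affine_poly (\<chi> i. Poly_Mapping.lookup f (?e i), Poly_Mapping.lookup f 0)"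
    using nz by (simp add: affine_poly_def sum.reindex[OF inj] del: One_nat_def)
  finally show ?thesis using that by blast
qed

subsection \<open>Gram matrices of sums of squares modulo an ideal\<close>

lemma poly_ideal_subspace: "poly_ideal I \<Longrightarrow> subspace I"
  by (simp add: poly_ideal_def subspace_def scaleR_eq_single_mult)

lemma poly_ideal_mult: "poly_ideal I \<Longrightarrow> p \<in> I \<Longrightarrow> p * q \<in> I"
  by (metis poly_ideal_def mult.commute)

text \<open>The defining condition applies with \<open>m = 1\<close> once \<open>h i\<close> is
  singled out.\<close>

lemma real_radical_sum_squares:
  assumes I: "real_radical I" and "(\<Sum>j<(t::nat). (h j)\<^sup>2) \<in> I" "i < t"
  shows "h i \<in> I"
proof -
  \<comment> \<open>Zeroing the entry at \<open>i\<close> keeps the index range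
    \<open>{..<t}\<close> demanded by \<open>real_radical\<close>.\<close>
  define g where "g j = (if j = i then 0 else h j)" for j
  have "(\<Sum>j<t. (h j)\<^sup>2) = (h i)\<^sup>2 + (\<Sum>j\<in>{..<t} - {i}. (h j)\<^sup>2)"
    using assms(3) by (simp add: sum.remove)
  also have "(\<Sum>j\<in>{..<t} - {i}. (h j)\<^sup>2) = (\<Sum>j<t. (g j)\<^sup>2)"
    by (rule sum.mono_neutral_cong_left) (auto simp: g_def)
  finally have "h i ^ (2 * 1) + (\<Sum>j<t. (g j)\<^sup>2) \<in> I"
    using assms(2) by simp
  then show ?thesis using I unfolding real_radical_def by blast
qed

lemma finite_bounded_degree: "finite {a::'n::finite \<Rightarrow>\<^sub>0 nat. (\<Sum>i\<in>UNIV. Poly_Mapping.lookup a i) \<le> k}"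
proof (rule finite_imageD)
  show "inj_on Poly_Mapping.lookup {a::'n \<Rightarrow>\<^sub>0 nat. (\<Sum>i\<in>UNIV. Poly_Mapping.lookup a i) \<le> k}"
    by (simp add: inj_on_def)
  have "Poly_Mapping.lookup a i \<le> k" if "(\<Sum>i\<in>UNIV. Poly_Mapping.lookup a i) \<le> k" for i and a::"'n \<Rightarrow>\<^sub>0 nat"
    using member_le_sum[of i UNIV "Poly_Mapping.lookup a"] that by simp
  then have "Poly_Mapping.lookup ` {a::'n \<Rightarrow>\<^sub>0 nat. (\<Sum>i\<in>UNIV. Poly_Mapping.lookup a i) \<le> k}
      \<subseteq> PiE UNIV (\<lambda>_. {..k})"
    by auto
  then show "finite (Poly_Mapping.lookup ` {a::'n \<Rightarrow>\<^sub>0 nat. (\<Sum>i\<in>UNIV. Poly_Mapping.lookup a i) \<le> k})"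
    by (rule finite_subset) (intro finite_PiE; simp)
qed

section \<open>Monomial bases modulo a subspace\<close>

definition comb :: "'a set \<Rightarrow> ('a \<Rightarrow> real) \<Rightarrow> 'a \<Rightarrow>\<^sub>0 real" where
  "comb B c = (\<Sum>b\<in>B. Poly_Mapping.single b (c b))"

lemma comb_scaleR: "r *\<^sub>R comb B c = comb B (\<lambda>b. r * c b)"
  by (simp add: comb_def scaleR_sum_right scaleR_single)

lemma comb_sum: "(\<Sum>j\<in>J. comb B (c j)) = comb B (\<lambda>b. \<Sum>j\<in>J. c j b)"
proof -
  have "Poly_Mapping.single b (\<Sum>j\<in>J. c j b) = (\<Sum>j\<in>J. Poly_Mapping.single b (c j b))" for b
    by (induction J rule: infinite_finite_induct) (simp_all add: single_add)
  then show ?thesis unfolding comb_def by (simp add: sum.swap[of _ J])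
qed

text \<open>\<open>B\<close> is a maximal set of monomials of degree at most \<open>k\<close> that
  is independent modulo \<open>I\<close>. By maximality every other such monomial satisfies a
  relation that can be solved for it.\<close>

lemma monomial_basis_modulo:
  fixes I :: "'n::finite rpoly set"
  assumes I: "subspace I"
  obtains B where "finite B"
    "\<And>c. comb B c \<in> polys_upto k"
    "\<And>c b. comb B c \<in> I \<Longrightarrow> b \<in> B \<Longrightarrow> c b = 0"
    "\<And>p. p \<in> polys_upto k \<Longrightarrow> \<exists>c. p - comb B c \<in> I"
proof -
  define M where "M = {a::'n \<Rightarrow>\<^sub>0 nat. (\<Sum>i\<in>UNIV. Poly_Mapping.lookup a i) \<le> k}"
  define indep where "indep B \<longleftrightarrow> (\<forall>c. comb B c \<in> I \<longrightarrow> (\<forall>b\<in>B. c b = 0))" for B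
  have finM: "finite M" unfolding M_def by (rule finite_bounded_degree)
  have "finite {B\<in>Pow M. indep B}" "{B\<in>Pow M. indep B} \<noteq> {}"
    using finM by (auto simp: indep_def intro: exI[of _ "{}"])
  from finite_has_maximal[OF this] obtain B where B: "B \<subseteq> M" "indep B"
    and max: "\<And>B'. B' \<subseteq> M \<Longrightarrow> indep B' \<Longrightarrow> B \<subseteq> B' \<Longrightarrow> B = B'"
    by auto
  have finB: "finite B" using B(1) finM by (rule finite_subset)
  have mon: "\<exists>c. Poly_Mapping.single a 1 - comb B c \<in> I" if "a \<in> M" for a
  proof (cases "a \<in> B")
    case True
    have "comb B (\<lambda>b. if b = a then 1 else 0) = (\<Sum>b\<in>B. if b = a then Poly_Mapping.single a 1 else 0)"
      unfolding comb_def by (rule sum.cong) auto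
    then have "comb B (\<lambda>b. if b = a then 1 else 0) = Poly_Mapping.single a 1"
      using True finB by simp
    then show ?thesis using subspace_0[OF I] by (intro exI[of _ "\<lambda>b. if b = a then 1 else 0"]) simp
  next
    case False
    then have "\<not> indep (insert a B)" using max[of "insert a B"] that B(1) by blast
    then obtain c where c: "comb (insert a B) c \<in> I" "\<not> (\<forall>b\<in>insert a B. c b = 0)"
      by (auto simp: indep_def)
    have split: "comb (insert a B) c = Poly_Mapping.single a (c a) + comb B c"
      using False finB by (simp add: comb_def)
    \<comment> \<open>With \<open>c a = 0\<close> the relation would involve only \<open>B\<close>,
      contradicting its independence.\<close>
    have ca: "c a \<noteq> 0"
      using c split B(2) by (auto simp: indep_def)
    have "Poly_Mapping.single a 1 - comb B (\<lambda>b. - (c b / c a)) = inverse (c a) *\<^sub>R comb (insert a B) c"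
      using ca unfolding split scaleR_right_distrib comb_scaleR
      by (simp add: scaleR_single comb_def single_uminus sum_negf divide_inverse mult.commute)
    then show ?thesis using subspace_scale[OF I c(1), of "inverse (c a)"] by metis
  qed
  have "\<exists>c. p - comb B c \<in> I" if "p \<in> polys_upto k" for p
  proof -
    have "Poly_Mapping.keys p \<subseteq> M" using that by (auto simp: polys_upto_def M_def)
    then have p: "p = (\<Sum>a\<in>M. Poly_Mapping.lookup p a *\<^sub>R Poly_Mapping.single a 1)"
      using poly_mapping_eq_sum_single[OF finM] by (simp add: scaleR_single)
    obtain d where d: "\<And>a. a \<in> M \<Longrightarrow> Poly_Mapping.single a 1 - comb B (d a) \<in> I"
      using mon by metis
    have "(\<Sum>a\<in>M. Poly_Mapping.lookup p a *\<^sub>R (Poly_Mapping.single a 1 - comb B (d a))) \<in> I"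
      by (intro subspace_sum[OF I] subspace_scale[OF I] d)
    also have "(\<Sum>a\<in>M. Poly_Mapping.lookup p a *\<^sub>R (Poly_Mapping.single a 1 - comb B (d a)))
        = p - comb B (\<lambda>b. \<Sum>a\<in>M. Poly_Mapping.lookup p a * d a b)"
      by (simp add: scaleR_right_diff_distrib sum_subtractf p[symmetric] comb_scaleR comb_sum)
    finally show ?thesis by blast
  qed
  moreover have "comb B c \<in> polys_upto k" for c
    unfolding comb_def using B(1) by (intro polys_upto_sum polys_upto_single) (auto simp: M_def)
  ultimately show ?thesis using that[of B] finB B(2) by (auto simp: indep_def)
qed

text \<open>The quadratic form of the matrix \<open>g\<close> evaluated at the monomials of
  \<open>B\<close>. Indexing by pairs fits the single index set of
  \<open>closed_linear_preimage_cone\<close>.\<close>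

definition gram_poly :: "'a::comm_monoid_add set \<Rightarrow> ('a \<times> 'a \<Rightarrow> real) \<Rightarrow> 'a \<Rightarrow>\<^sub>0 real" where
  "gram_poly B g = (\<Sum>t\<in>B \<times> B. g t *\<^sub>R Poly_Mapping.single (fst t + snd t) 1)"

lemma gram_poly_outer_sum:
  assumes "\<And>a b. a \<in> B \<Longrightarrow> b \<in> B \<Longrightarrow> g (a, b) = (\<Sum>j<(t::nat). c j a * c j b)"
  shows "gram_poly B g = (\<Sum>j<t. (comb B (c j))\<^sup>2)"
proof -
  have single_sum: "Poly_Mapping.single a (\<Sum>j<t. f j) = (\<Sum>j<t. Poly_Mapping.single a (f j :: real))"
    for a :: 'a and f
    by (induction t) (simp_all add: single_add)
  have "(\<Sum>j<t. (comb B (c j))\<^sup>2) = (\<Sum>j<t. \<Sum>a\<in>B. \<Sum>b\<in>B. Poly_Mapping.single (a + b) (c j a * c j b))"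
    by (simp add: comb_def power2_eq_square sum_product mult_single)
  also have "\<dots> = (\<Sum>a\<in>B. \<Sum>b\<in>B. \<Sum>j<t. Poly_Mapping.single (a + b) (c j a * c j b))"
    by (subst sum.swap, rule sum.cong, simp, subst sum.swap, simp)
  also have "\<dots> = gram_poly B g"
    unfolding gram_poly_def sum.cartesian_product'
    by (simp add: assms scaleR_single single_sum cong: sum.cong)
  finally show ?thesis by simp
qed

text \<open>Squares may be taken of representatives over \<open>B\<close>, and the coefficient
  vectors of these give the matrix. Conversely \<open>psd_on_decomp\<close> reads squares off a
  matrix. The number of squares is thereby traded for a matrix of fixed size.\<close>

lemma ksos_mod_iff_gram:
  assumes I: "poly_ideal I" and B: "finite B"
    "\<And>c. comb B c \<in> polys_upto k"
    "\<And>p. p \<in> polys_upto k \<Longrightarrow> \<exists>c. p - comb B c \<in> I"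
  shows "ksos_mod k I f \<longleftrightarrow> (\<exists>g. psd_on B (curry g) \<and> f - gram_poly B g \<in> I)"
proof
  assume "ksos_mod k I f"
  then obtain t :: nat and h where h: "\<And>j. j < t \<Longrightarrow> h j \<in> polys_upto k" "f - (\<Sum>j<t. (h j)\<^sup>2) \<in> I"
    unfolding ksos_mod_def by blast
  have "\<forall>j\<in>{..<t}. \<exists>c. h j - comb B c \<in> I" using B(3) h(1) by blast
  from bchoice[OF this] obtain c where c: "\<And>j. j < t \<Longrightarrow> h j - comb B (c j) \<in> I" by blast
  define g where "g = (\<lambda>(a, b). \<Sum>j<t. c j a * c j b)"
  \<comment> \<open>A difference of squares has the factor \<open>h j - comb B (c j)\<close>, which
    lies in \<open>I\<close>.\<close>
  have "(h j)\<^sup>2 - (comb B (c j))\<^sup>2 \<in> I" if "j < t" for j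
    using poly_ideal_mult[OF I c[OF that], of "h j + comb B (c j)"]
    by (simp add: power2_eq_square algebra_simps)
  then have "(\<Sum>j<t. (h j)\<^sup>2 - (comb B (c j))\<^sup>2) \<in> I"
    by (intro subspace_sum[OF poly_ideal_subspace[OF I]]) simp
  from subspace_add[OF poly_ideal_subspace[OF I] h(2) this]
  have "f - gram_poly B g \<in> I"
    by (simp add: gram_poly_outer_sum[where t = t and c = c] g_def sum_subtractf)
  moreover have "psd_on B (curry g)"
    using psd_on_outer_sum[OF B(1), where t = t and c = c] by (simp add: g_def curry_def)
  ultimately show "\<exists>g. psd_on B (curry g) \<and> f - gram_poly B g \<in> I" by blast
next
  assume "\<exists>g. psd_on B (curry g) \<and> f - gram_poly B g \<in> I"
  then obtain g where g: "psd_on B (curry g)" "f - gram_poly B g \<in> I" by blast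
  obtain t :: nat and c where "\<forall>a\<in>B. \<forall>b\<in>B. curry g a b = (\<Sum>j<t. c j a * c j b)"
    using psd_on_decomp[OF B(1) g(1)] by blast
  then have "gram_poly B g = (\<Sum>j<t. (comb B (c j))\<^sup>2)"
    by (intro gram_poly_outer_sum) simp
  then show "ksos_mod k I f"
    unfolding ksos_mod_def using g(2) B(2) by (intro exI[of _ t] exI[of _ "\<lambda>j. comb B (c j)"]) simp
qed

text \<open>\<open>L\<close> is the preimage of the cone of Gram polynomials modulo
  \<open>I\<close>; closedness comes from \<open>closed_linear_preimage_cone\<close> with the
  positive semidefinite matrices as \<open>C\<close>.\<close>

lemma affine_ksos_cone:
  fixes I :: "'n::finite rpoly set" and k :: nat
  assumes I: "poly_ideal I" and rad: "real_radical I"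
  defines "L \<equiv> {z. ksos_mod k I (affine_poly z)}"
  shows "closed L" and "convex L" and "\<And>z r. z \<in> L \<Longrightarrow> 0 \<le> r \<Longrightarrow> r *\<^sub>R z \<in> L"
proof -
  note sub = poly_ideal_subspace[OF I]
  obtain B where B: "finite B" "\<And>c. comb B c \<in> polys_upto k"
    "\<And>c b. comb B c \<in> I \<Longrightarrow> b \<in> B \<Longrightarrow> c b = 0"
    "\<And>p. p \<in> polys_upto k \<Longrightarrow> \<exists>c. p - comb B c \<in> I"
    using monomial_basis_modulo[OF sub] by blast
  have iff: "ksos_mod k I f \<longleftrightarrow> (\<exists>g. psd_on B (curry g) \<and> f - gram_poly B g \<in> I)" for f
    by (rule ksos_mod_iff_gram[OF I B(1,2,4)])
  have L: "L = {z. \<exists>g\<in>{g. psd_on B (curry g)}. affine_poly z -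
      (\<Sum>t\<in>B \<times> B. g t *\<^sub>R Poly_Mapping.single (fst t + snd t) 1) \<in> I}"
    unfolding L_def iff gram_poly_def by auto
  show "closed L" unfolding L
  proof (rule closed_linear_preimage_cone[OF linear_affine_poly sub])
    show "finite (B \<times> B)" using B(1) by simp
  next
    fix g :: "_ \<Rightarrow> real" and r :: real assume "g \<in> {g. psd_on B (curry g)}" "0 \<le> r"
    then show "(\<lambda>t. r * g t) \<in> {g. psd_on B (curry g)}"
      using psd_on_scale[of B "curry g" r] by (simp add: curry_def)
  next
    fix f :: "nat \<Rightarrow> _ \<Rightarrow> real" and g
    assume "\<And>m. f m \<in> {g. psd_on B (curry g)}" "\<And>t. t \<in> B \<times> B \<Longrightarrow> (\<lambda>m. f m t) \<longlonglongrightarrow> g t"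
    then show "g \<in> {g. psd_on B (curry g)}"
      using psd_on_limit[of B "\<lambda>m. curry (f m)" "curry g"] by simp
  next
    \<comment> \<open>A Gram polynomial in \<open>I\<close> is a sum of squares in \<open>I\<close>.
      Real radicality puts each summand's root in \<open>I\<close>, and independence of
      \<open>B\<close> modulo \<open>I\<close> kills its coefficients.\<close>
    fix g t assume g: "g \<in> {g. psd_on B (curry g)}" and t: "t \<in> B \<times> B"
      and gI: "(\<Sum>t\<in>B \<times> B. g t *\<^sub>R Poly_Mapping.single (fst t + snd t) 1) \<in> I"
    obtain s :: nat and c where
      c: "\<forall>a\<in>B. \<forall>b\<in>B. curry g a b = (\<Sum>j<s. c j a * c j b)"
      using psd_on_decomp[OF B(1), of "curry g"] g by blast
    then have "gram_poly B g = (\<Sum>j<s. (comb B (c j))\<^sup>2)"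
      by (intro gram_poly_outer_sum) simp
    then have "(\<Sum>j<s. (comb B (c j))\<^sup>2) \<in> I" using gI by (simp add: gram_poly_def)
    then have "comb B (c j) \<in> I" if "j < s" for j
      using real_radical_sum_squares[OF rad, of "\<lambda>j. comb B (c j)"] that by blast
    then have "c j b = 0" if "j < s" "b \<in> B" for j b
      using B(3) that by blast
    then show "g t = 0" using c t by auto
  qed
  have scaled: "r *\<^sub>R z \<in> L" if "z \<in> L" "0 \<le> r" for z r
  proof -
    obtain g where g: "psd_on B (curry g)" "affine_poly z - gram_poly B g \<in> I"
      using \<open>z \<in> L\<close> unfolding L_def iff by blast
    have "affine_poly (r *\<^sub>R z) - gram_poly B (\<lambda>t. r * g t) \<in> I"
      using subspace_scale[OF sub g(2), of r]
      by (simp add: linear_scale[OF linear_affine_poly] gram_poly_def scaleR_right_diff_distrib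
          scaleR_sum_right)
    moreover have "psd_on B (curry (\<lambda>t. r * g t))"
      using psd_on_scale[OF g(1) \<open>0 \<le> r\<close>] by (simp add: curry_def)
    ultimately show ?thesis
      unfolding L_def iff by blast
  qed
  then show "\<And>z r. z \<in> L \<Longrightarrow> 0 \<le> r \<Longrightarrow> r *\<^sub>R z \<in> L" by blast
  have add: "y + z \<in> L" if yz: "y \<in> L" "z \<in> L" for y z
  proof -
    obtain g where g: "psd_on B (curry g)" "affine_poly y - gram_poly B g \<in> I"
      using \<open>y \<in> L\<close> unfolding L_def iff by blast
    obtain h where h: "psd_on B (curry h)" "affine_poly z - gram_poly B h \<in> I"
      using \<open>z \<in> L\<close> unfolding L_def iff by blast
    have "affine_poly (y + z) - gram_poly B (\<lambda>t. g t + h t) \<in> I"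
      using subspace_add[OF sub g(2) h(2)]
      by (simp add: linear_add[OF linear_affine_poly] gram_poly_def scaleR_left_distrib
          sum.distrib algebra_simps)
    moreover have "psd_on B (curry (\<lambda>t. g t + h t))"
      using psd_on_add[OF g(1) h(1)] by (simp add: curry_def)
    ultimately show ?thesis
      unfolding L_def iff by blast
  qed
  show "convex L" using scaled add by (simp add: convex_def)
qed

subsection \<open>Theta bodies\<close>

lemma ksos_mod_nonneg_on_variety:
  assumes "ksos_mod k I f" "x \<in> real_variety I"
  shows "0 \<le> eval_rpoly f x"
proof -
  obtain t :: nat and h where "f - (\<Sum>j<t. (h j)\<^sup>2) \<in> I"
    using assms(1) by (auto simp: ksos_mod_def)
  then have "eval_rpoly (f - (\<Sum>j<t. (h j)\<^sup>2)) x = 0"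
    using assms(2) by (simp add: real_variety_def)
  then have "eval_rpoly f x = (\<Sum>j<t. (eval_rpoly (h j) x)\<^sup>2)"
    by (simp add: eval_rpoly_linear eval_rpoly_mult power2_eq_square)
  then show ?thesis by (simp add: sum_nonneg)
qed

text \<open>A closed half-space containing \<open>S\<close> contains its closed convex hull.\<close>

lemma affine_nonneg_on_closed_hull:
  assumes "\<And>x. x \<in> S \<Longrightarrow> 0 \<le> a \<bullet> x + b" and "x \<in> closure (convex hull S)"
  shows "0 \<le> a \<bullet> x + (b::real)"
proof -
  have H: "{x. 0 \<le> a \<bullet> x + b} = {x. a \<bullet> x \<ge> - b}" by auto
  have "closure (convex hull S) \<subseteq> {x. 0 \<le> a \<bullet> x + b}"
    unfolding H
    by (intro closure_minimal hull_minimal closed_halfspace_ge convex_halfspace_ge)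
      (use assms(1) in force)
  then show ?thesis using assms(2) by blast
qed

lemma closed_hull_subset_theta_body:
  "closure (convex hull (real_variety I)) \<subseteq> theta_body k I"
proof (clarsimp simp: theta_body_def)
  fix x f assume x: "x \<in> closure (convex hull real_variety I)"
    and f: "f \<in> polys_upto (Suc 0)" "ksos_mod k I f"
  obtain z where z: "f = affine_poly z" using polys_upto_1_cases f(1) by auto
  show "0 \<le> eval_rpoly f x"
    using ksos_mod_nonneg_on_variety[OF f(2)] affine_nonneg_on_closed_hull[OF _ x, of "fst z" "snd z"]
    by (simp add: z eval_affine_poly)
qed

lemma one_k_sos_imp_theta_exact:
  assumes "one_k_sos k I"
  shows "theta_exact k I"
proof -
  have "theta_body k I \<subseteq> closure (convex hull (real_variety I))"
  proof
    fix x assume x: "x \<in> theta_body k I"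
    show "x \<in> closure (convex hull (real_variety I))"
    proof (rule ccontr)
      assume "\<not> ?thesis"
      from separating_hyperplane_closed_point[OF convex_closure[OF convex_convex_hull] closed_closure this]
      obtain a b where
        ab: "a \<bullet> x < b" "\<And>y. y \<in> closure (convex hull (real_variety I)) \<Longrightarrow> b < a \<bullet> y"
        by blast
      let ?f = "affine_poly (a, - b)"
      have "0 \<le> eval_rpoly ?f y" if "y \<in> real_variety I" for y
        using ab(2)[of y] subsetD[OF closure_subset hull_inc[OF that]]
        by (simp add: eval_affine_poly)
      then have "ksos_mod k I ?f"
        using assms affine_poly_in_polys_upto unfolding one_k_sos_def by blast
      then have "0 \<le> eval_rpoly ?f x"
        using x affine_poly_in_polys_upto unfolding theta_body_def by blast
      then show False using ab(1) by (simp add: eval_affine_poly)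
    qed
  qed
  then show ?thesis
    using closed_hull_subset_theta_body unfolding theta_exact_def by blast
qed

section \<open>Duality between affine sums of squares and the theta body\<close>

lemma separate_closed_cone_point:
  fixes L :: "'a::euclidean_space set"
  assumes "closed L" "convex L" "\<And>z r. z \<in> L \<Longrightarrow> 0 \<le> r \<Longrightarrow> r *\<^sub>R z \<in> L" "0 \<in> L" "w \<notin> L"
  obtains a where "a \<bullet> w < 0" "\<And>z. z \<in> L \<Longrightarrow> 0 \<le> a \<bullet> z"
proof -
  obtain a b where ab: "a \<bullet> w < b" "\<And>z. z \<in> L \<Longrightarrow> b < a \<bullet> z"
    using separating_hyperplane_closed_point[OF assms(2,1,5)] by blast
  have b: "b < 0" using ab(2)[OF assms(4)] by simp
  have "0 \<le> a \<bullet> z" if "z \<in> L" for z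
  proof (rule ccontr)
    assume neg: "\<not> 0 \<le> a \<bullet> z"
    \<comment> \<open>Both \<open>b\<close> and \<open>a \<bullet> z\<close> are negative, so the
      factor is nonnegative; the scaled point has value exactly \<open>b\<close>, against the strict
      bound.\<close>
    then have "b < a \<bullet> ((b / (a \<bullet> z)) *\<^sub>R z)"
      using b by (intro ab(2) assms(3) that) (simp add: divide_nonpos_nonpos)
    then show False using neg by simp
  qed
  then show ?thesis using that[of a] ab(1) b by simp
qed

lemma one_in_polys_upto: "1 \<in> polys_upto k"
  by (simp add: polys_upto_def)

lemma ksos_mod_one: "poly_ideal I \<Longrightarrow> ksos_mod k I 1"
  unfolding ksos_mod_def
  by (intro exI[of _ "Suc 0"] exI[of _ "\<lambda>_. 1"]) (simp add: one_in_polys_upto poly_ideal_def)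

lemma affine_poly_const: "affine_poly (0, c) = Poly_Mapping.single 0 c"
  by (simp add: affine_poly_def)

text \<open>Here \<open>1\<close> plus a sum of squares lies in \<open>I\<close>, so
  \<open>1\<close> does by real radicality, and \<open>I\<close> is the whole ring.\<close>

lemma ksos_mod_neg_one_imp:
  assumes I: "poly_ideal I" and rad: "real_radical I" and "ksos_mod k I (- 1)"
  shows "ksos_mod k I f"
proof -
  obtain t :: nat and h where h: "- 1 - (\<Sum>j<t. (h j)\<^sup>2) \<in> I"
    using assms(3) by (auto simp: ksos_mod_def)
  have "1 ^ (2 * 1) + (\<Sum>j<t. (h j)\<^sup>2) \<in> I"
    using subspace_neg[OF poly_ideal_subspace[OF I] h] by (simp add: add.commute)
  then have "1 \<in> I" using rad unfolding real_radical_def by blast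
  then have "f \<in> I" using poly_ideal_mult[OF I, of 1 f] by simp
  then show ?thesis unfolding ksos_mod_def by (intro exI[of _ 0]) simp
qed

lemma eval_affine_poly_homogeneous:
  assumes "0 < s"
  shows "eval_rpoly (affine_poly z) (inverse s *\<^sub>R y) = inverse s * ((y, s) \<bullet> z)"
  using assms by (simp add: eval_affine_poly inner_prod_def inner_commute[of y] field_simps)

text \<open>A functional nonnegative on the cone is, when \<open>s > 0\<close>, a positive multiple
  of evaluation at a point.\<close>

lemma in_theta_body_if_dual:
  assumes "0 < s" and "\<And>z. ksos_mod k I (affine_poly z) \<Longrightarrow> 0 \<le> (y, s) \<bullet> z"
  shows "inverse s *\<^sub>R y \<in> theta_body k I"
  unfolding theta_body_def
proof (clarify)
  fix f assume f: "f \<in> polys_upto 1" "ksos_mod k I f"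
  obtain z where z: "f = affine_poly z" using polys_upto_1_cases f(1) by auto
  have "0 \<le> inverse s * ((y, s) \<bullet> z)"
    using assms f(2) z by simp
  also have "\<dots> = eval_rpoly f (inverse s *\<^sub>R y)"
    unfolding z by (rule eval_affine_poly_homogeneous[OF assms(1), symmetric])
  finally show "0 \<le> eval_rpoly f (inverse s *\<^sub>R y)" .
qed

lemma theta_body_duality:
  assumes I: "poly_ideal I" and rad: "real_radical I"
    and f: "f \<in> polys_upto 1" and nonneg: "\<And>x. x \<in> theta_body k I \<Longrightarrow> 0 \<le> eval_rpoly f x"
  shows "ksos_mod k I f"
proof -
  define L where "L = {z. ksos_mod k I (affine_poly z)}"
  note cone = affine_ksos_cone[OF I rad, where k = k, folded L_def]
  have one: "(0, 1) \<in> L"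
    using ksos_mod_one[OF I] by (simp add: L_def affine_poly_const)
  have zero: "0 \<in> L" using cone(3)[OF one, of 0] by (simp add: zero_prod_def)
  \<comment> \<open>The sign of \<open>s\<close> comes from pairing with \<open>(0, 1)\<close>,
    which lies in \<open>L\<close>.\<close>
  have sep: "\<exists>y s. (y, s) \<bullet> w < 0 \<and> 0 \<le> s \<and> (\<forall>z\<in>L. 0 \<le> (y, s) \<bullet> z)" if "w \<notin> L" for w
  proof -
    obtain a where "a \<bullet> w < 0" "\<And>z. z \<in> L \<Longrightarrow> 0 \<le> a \<bullet> z"
      using separate_closed_cone_point[OF cone zero \<open>w \<notin> L\<close>] by blast
    then show ?thesis using one by (cases a) force
  qed
  obtain w where w: "f = affine_poly w" using polys_upto_1_cases[OF f] by blast
  show ?thesis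
  proof (cases "theta_body k I = {}")
    case True
    have "(0, - 1) \<in> L"
    proof (rule ccontr)
      assume "(0, - 1) \<notin> L"
      \<comment> \<open>Negativity at \<open>(0, - 1)\<close> says precisely that \<open>s\<close>
        is positive.\<close>
      from sep[OF this] obtain y s where "0 < s" "\<forall>z\<in>L. 0 \<le> (y, s) \<bullet> z" by auto
      then show False using in_theta_body_if_dual[of s k I y] True by (auto simp: L_def)
    qed
    then have "ksos_mod k I (- 1)" by (simp add: L_def affine_poly_const single_uminus)
    then show ?thesis by (rule ksos_mod_neg_one_imp[OF I rad])
  next
    case False
    then obtain x where x: "x \<in> theta_body k I" by blast
    have xL: "0 \<le> (x, 1) \<bullet> z" if "z \<in> L" for z
    proof -
      have "0 \<le> eval_rpoly (affine_poly z) x"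
        using x affine_poly_in_polys_upto that unfolding theta_body_def L_def by blast
      then show ?thesis by (simp add: eval_affine_poly inner_prod_def inner_commute)
    qed
    have "w \<in> L"
    proof (rule ccontr)
      assume "w \<notin> L"
      from sep[OF this] obtain y s where ys: "(y, s) \<bullet> w < 0" "0 \<le> s" "\<And>z. z \<in> L \<Longrightarrow> 0 \<le> (y, s) \<bullet> z"
        by blast
      \<comment> \<open>This \<open>e\<close> limits the contribution of \<open>(x, 1)\<close> at
        \<open>w\<close> to half of the negative gap; the summand 1 keeps the denominator
        positive.\<close>
      define e where "e = - ((y, s) \<bullet> w) / (2 * (1 + \<bar>(x, 1) \<bullet> w\<bar>))"
      have e: "0 < e" unfolding e_def by (rule divide_pos_pos) (use ys(1) in \<open>simp_all add: add_pos_nonneg\<close>)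
      have "e * ((x, 1) \<bullet> w) \<le> e * (1 + \<bar>(x, 1) \<bullet> w\<bar>)"
        using e by (intro mult_left_mono) auto
      also have "\<dots> = - ((y, s) \<bullet> w) / 2"
        by (simp add: e_def field_simps)
      finally have neg: "(y, s) \<bullet> w + e * ((x, 1) \<bullet> w) < 0"
        using ys(1) by linarith
      have eq: "(y + e *\<^sub>R x, s + e) \<bullet> z = (y, s) \<bullet> z + e * ((x, 1) \<bullet> z)" for z
        by (simp add: inner_prod_def inner_add_left algebra_simps)
      \<comment> \<open>The perturbation handles \<open>s = 0\<close>, where \<open>(y, s)\<close>
        itself represents no point.\<close>
      have "0 < s + e" using ys(2) e by simp
      moreover have "0 \<le> (y + e *\<^sub>R x, s + e) \<bullet> z" if "ksos_mod k I (affine_poly z)" for z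
        unfolding eq using ys(3) xL e that by (simp add: L_def)
      ultimately have "inverse (s + e) *\<^sub>R (y + e *\<^sub>R x) \<in> theta_body k I"
        by (rule in_theta_body_if_dual)
      then have "0 \<le> eval_rpoly f (inverse (s + e) *\<^sub>R (y + e *\<^sub>R x))" by (rule nonneg)
      also have "\<dots> = inverse (s + e) * ((y + e *\<^sub>R x, s + e) \<bullet> w)"
        unfolding w by (rule eval_affine_poly_homogeneous[OF \<open>0 < s + e\<close>])
      also have "\<dots> < 0"
        using \<open>0 < s + e\<close> neg unfolding eq by (simp add: mult_pos_neg)
      finally show False by simp
    qed
    then show ?thesis by (simp add: L_def w)
  qed
qed

theorem corollary2p12:
  fixes I :: "'n::finite rpoly set" and k :: nat
  assumes "poly_ideal I" and "real_radical I" and "k \<ge> 1"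
  shows "one_k_sos k I \<longleftrightarrow> theta_exact k I"
proof
  assume exact: "theta_exact k I"
  show "one_k_sos k I"
    unfolding one_k_sos_def
  proof (intro ballI impI)
    fix f assume f: "f \<in> polys_upto 1" and nn: "\<forall>x\<in>real_variety I. 0 \<le> eval_rpoly f x"
    obtain z where z: "f = affine_poly z" using polys_upto_1_cases[OF f] by blast
    have "0 \<le> eval_rpoly f x" if "x \<in> theta_body k I" for x
      using that exact nn affine_nonneg_on_closed_hull[of "real_variety I" "fst z" "snd z" x]
      by (simp add: theta_exact_def z eval_affine_poly)
    then show "ksos_mod k I f" by (rule theta_body_duality[OF assms(1,2) f])
  qed
qed (rule one_k_sos_imp_theta_exact)

end
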